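(* Consider a signed graph with $n$ nodes, $m$ edges, incidence matrix $D$, weight matrix $W=\mathrm{diag}(w_1,\dots,w_m)$, signed Laplacian $L=DWD^\top$, and a single negative edge $l_-$, between two distinct nodes $i$ and $j$, with weight $w_{l_-}=-k<0$, so that $w_l>0$ for all $l\ne l_-$. Let $L_+=D_+W_+D_+^\top$ be the unsigned Laplacian of the graph with $n$ nodes and $m-1$ edges obtained by removing the edge $l_-$. Suppose that the graph defined by $L_+$ is connected and let $r_{ij}=(L_+^\dagger)_{ii}+(L_+^\dagger)_{jj}-2(L_+^\dagger)_{ij}>0$. Then: 1) If $k<r_{ij}^{-1}$, then $L$ is positive semidefinite and $\operatorname{corank} L=1$. The restriction of $L$ to $\mathbf 1_n^\perp$ is positive definite. 2) If $k=r_{ij}^{-1}$, then $L$ is positive semidefinite, $\operatorname{corank} L=2$, and $Lv=0$, where $v=L_+^\dagger e_{ij}\in\mathbf 1_n^\perp$. 3) If $k>r_{ij}^{-1}$, then $L$ is indefinite and $\operatorname{corank} L=1$.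
   Context: The incidence matrix $D\in\mathbb{R}^{n\times m}$ has, in the column of an edge between two nodes, one entry $1$ and one entry $-1$ at the positions of these nodes and zeros elsewhere; $D_+$ and $W_+$ are obtained from $D$ and $W$ by deleting the data of the edge $l_-$. $M^\dagger$ is the Moore-Penrose pseudoinverse of $M$. $\mathbf 1_n\in\mathbb{R}^n$ is the all-ones vector and $\mathbf 1_n^\perp$ its orthogonal complement. $e_{ij}\in\mathbb{R}^n$ is the vector with $1$ at position $i$, $-1$ at position $j$, and zero elsewhere. $\operatorname{corank} M=\dim\ker M$. The number $r_{ij}$ is the effective resistance between nodes $i$ and $j$ in the graph defined by $L_+$.
   Formalization: In 3), indefiniteness of L is claimed only for n ≥ 3 (for every n, L is not positive semidefinite and corank L = 1): with n = 2 and parallel edges of weights 1 and -2, L is negative semidefinite, so not indefinite. *)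

theory Defs
  imports "HOL-Analysis.Analysis"
begin

definition e_vec :: "'n \<Rightarrow> 'n \<Rightarrow> real ^ ('n::finite)"
  where "e_vec i j = (\<chi> u. if u = i then 1 else if u = j then - 1 else 0)"

text \<open>
  A graph on the node type is a family of two-element sets of nodes, indexed by the type of
  edges. The orientation of each column of an incidence matrix is arbitrary.
\<close>

definition incidence_matrix :: "('m \<Rightarrow> 'n set) \<Rightarrow> real ^ 'm ^ 'n \<Rightarrow> bool"
  where "incidence_matrix ends D \<longleftrightarrow>
    (\<forall>l. \<exists>u v. u \<noteq> v \<and> ends l = {u, v} \<and> column l D = e_vec u v)"

definition graph_connected :: "('m \<Rightarrow> 'n set) \<Rightarrow> bool"
  where "graph_connected ends \<longleftrightarrow> (\<forall>u v. (u, v) \<in> {(a, b). \<exists>l. ends l = {a, b}}\<^sup>*)"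

definition diag_matrix :: "('m \<Rightarrow> real) \<Rightarrow> real ^ 'm ^ 'm"
  where "diag_matrix w = (\<chi> l l'. if l = l' then w l else 0)"

text \<open>
  Deletion of edges: if \<open>f\<close> enumerates the remaining edges, only the columns of the incidence
  matrix, resp. the rows and columns of the weight matrix, with an index in the range of \<open>f\<close>
  are kept.
\<close>

definition keep_columns :: "('p \<Rightarrow> 'm) \<Rightarrow> real ^ 'm ^ 'n \<Rightarrow> real ^ 'p ^ 'n"
  where "keep_columns f D = (\<chi> u p. D $ u $ f p)"

definition keep_rows_columns :: "('p \<Rightarrow> 'm) \<Rightarrow> real ^ 'm ^ 'm \<Rightarrow> real ^ 'p ^ 'p"
  where "keep_rows_columns f W = (\<chi> p q. W $ f p $ f q)"

text \<open>The Moore-Penrose pseudoinverse, as the unique solution of the four Penrose equations.\<close>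

definition is_pseudoinverse :: "real ^ 'm ^ 'n \<Rightarrow> real ^ 'n ^ 'm \<Rightarrow> bool"
  where "is_pseudoinverse A X \<longleftrightarrow>
    A ** X ** A = A \<and> X ** A ** X = X \<and>
    transpose (A ** X) = A ** X \<and> transpose (X ** A) = X ** A"

definition pseudoinverse :: "real ^ 'm ^ 'n \<Rightarrow> real ^ 'n ^ 'm"
  where "pseudoinverse A = (THE X. is_pseudoinverse A X)"

definition effective_resistance :: "real ^ 'n ^ 'n \<Rightarrow> 'n \<Rightarrow> 'n \<Rightarrow> real"
  where "effective_resistance A i j =
    pseudoinverse A $ i $ i + pseudoinverse A $ j $ j - 2 * pseudoinverse A $ i $ j"

definition corank :: "real ^ 'm ^ 'n \<Rightarrow> nat"
  where "corank A = dim {x. A *v x = 0}"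

definition pos_semidef :: "real ^ 'n ^ 'n \<Rightarrow> bool"
  where "pos_semidef A \<longleftrightarrow> transpose A = A \<and> (\<forall>x. 0 \<le> x \<bullet> (A *v x))"

definition pos_def_on :: "(real ^ 'n) set \<Rightarrow> real ^ 'n ^ 'n \<Rightarrow> bool"
  where "pos_def_on S A \<longleftrightarrow> transpose A = A \<and> (\<forall>x\<in>S. x \<noteq> 0 \<longrightarrow> 0 < x \<bullet> (A *v x))"

text \<open>
  On two nodes, a signed Laplacian whose total edge weight is negative is negative semidefinite,
  hence not indefinite in the following sense.
\<close>

definition indefinite :: "real ^ 'n ^ 'n \<Rightarrow> bool"
  where "indefinite A \<longleftrightarrow> transpose A = A \<and>
    (\<exists>x. 0 < x \<bullet> (A *v x)) \<and> (\<exists>x. x \<bullet> (A *v x) < 0)"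

end

(* Removing the edge l_- gives L = L_+ - k e e^T with e = e_ij. As L_+ is positive semidefinite
   with kernel spanned by 1, the vector v = L_+^\<dagger> e satisfies L_+ v = e and r = v \<bullet> e = v \<bullet> L_+ v.
   Completing the square in the L_+-inner product along v gives
     x \<bullet> L x = (x - t v) \<bullet> L_+ (x - t v) + (1/r - k) (e \<bullet> x)^2,   t = (e \<bullet> x) / r,
   and every x in ker L differs from a multiple of v by a constant vector. *)

theory Submission
  imports Defs
begin

section \<open>The Moore-Penrose pseudoinverse: uniqueness and the symmetric case\<close>

text \<open>The first Penrose equation for \<open>Y\<close> gives
  \<open>A ** X = (A ** Y) ** (A ** X)\<close>; transposing swaps the two symmetric factors, and
  their product is then \<open>A ** Y\<close>. Likewise \<open>X ** A = Y ** A\<close>, so X = X A X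
  = Y A Y = Y.\<close>

lemma is_pseudoinverse_unique:
  assumes "is_pseudoinverse A X" "is_pseudoinverse A Y"
  shows "X = Y"
proof -
  have X: "A ** X ** A = A" "X ** A ** X = X" "transpose (A ** X) = A ** X" "transpose (X ** A) = X ** A"
    and Y: "A ** Y ** A = A" "Y ** A ** Y = Y" "transpose (A ** Y) = A ** Y" "transpose (Y ** A) = Y ** A"
    using assms by (auto simp: is_pseudoinverse_def)
  have "A ** X = transpose ((A ** Y) ** (A ** X))"
    using X(3) Y(1) by (simp add: matrix_mul_assoc)
  also have "\<dots> = (A ** X) ** (A ** Y)"
    by (simp only: matrix_transpose_mul[of "A ** Y"] X(3) Y(3))
  also have "\<dots> = A ** Y"
    using X(1) by (simp add: matrix_mul_assoc)
  finally have AX: "A ** X = A ** Y" .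
  have "X ** A = transpose ((X ** A) ** (Y ** A))"
    using X(4) Y(1) by (simp add: matrix_mul_assoc[symmetric])
  also have "\<dots> = (Y ** A) ** (X ** A)"
    by (simp only: matrix_transpose_mul[of "X ** A"] X(4) Y(4))
  also have "\<dots> = Y ** A"
    using X(1) by (simp add: matrix_mul_assoc[symmetric])
  finally have XA: "X ** A = Y ** A" .
  have "X = X ** A ** X" using X by simp
  also have "\<dots> = Y ** A ** Y" by (metis AX XA matrix_mul_assoc)
  also have "\<dots> = Y" using Y by simp
  finally show ?thesis .
qed

lemma pseudoinverse_eqI: "is_pseudoinverse A X \<Longrightarrow> pseudoinverse A = X"
  unfolding pseudoinverse_def by (blast intro: is_pseudoinverse_unique)

lemma matrix_sub_ldistrib: "A ** (B - C) = A ** B - A ** (C :: 'a::ring_1 ^ 'n ^ 'm)"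
  by (vector matrix_matrix_mult_def) (simp add: right_diff_distrib sum_subtractf)

lemma matrix_sub_rdistrib: "(A - B) ** C = A ** C - B ** (C :: 'a::ring_1 ^ 'n ^ 'm)"
  by (vector matrix_matrix_mult_def) (simp add: left_diff_distrib sum_subtractf)

lemma matrix_add_rdistrib: "(A + B) ** C = A ** C + B ** (C :: 'a::semiring_1 ^ 'n ^ 'm)"
  by (vector matrix_matrix_mult_def) (simp add: distrib_right sum.distrib)

lemma transpose_diff: "transpose (A - B) = transpose A - transpose (B :: 'a::ab_group_add ^ 'n ^ 'm)"
  by (simp add: transpose_def vec_eq_iff)

lemma transpose_add: "transpose (A + B) = transpose A + transpose (B :: 'a::ab_group_add ^ 'n ^ 'm)"
  by (simp add: transpose_def vec_eq_iff)

lemma symmetric_inner_matrix_vector: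
  fixes A :: "real ^ 'n ^ 'n"
  assumes "transpose A = A"
  shows "x \<bullet> (A *v y) = (A *v x) \<bullet> y"
  by (metis assms dot_lmul_matrix vector_transpose_matrix)

(* Here E is the orthogonal projection onto the kernel of A. *)
lemma symmetric_pseudoinverse:
  fixes A E :: "real ^ 'n ^ 'n"
  assumes A: "transpose A = A" and E: "transpose E = E" "E ** E = E" and AE: "A ** E = 0"
    and ker: "\<And>x. A *v x = 0 \<Longrightarrow> E *v x = 0 \<Longrightarrow> x = 0"
  shows "transpose (pseudoinverse A) = pseudoinverse A"
    and "A ** pseudoinverse A = mat 1 - E" and "E ** pseudoinverse A = 0"
proof -
  have EA: "E ** A = 0"
    using arg_cong[OF AE, of transpose]
    by (simp add: matrix_transpose_mul A E) (simp add: transpose_def vec_eq_iff)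
  \<comment> \<open>Adding the projection \<open>E\<close> makes \<open>A\<close> invertible:
    \<open>B\<close> acts as \<open>A\<close> on the range of \<open>A\<close> and as the identity
    on the range of \<open>E\<close>.\<close>
  define B where "B = A + E"
  have BE: "B ** E = E" and EB: "E ** B = E"
    by (simp_all add: B_def matrix_add_rdistrib matrix_add_ldistrib AE EA E)
  have "x = 0" if "B *v x = 0" for x
  proof -
    have "E *v x = E *v (B *v x)"
      by (simp add: matrix_vector_mul_assoc EB)
    then have Ex: "E *v x = 0" using that by simp
    then have "A *v x = 0"
      using that by (simp add: B_def matrix_vector_mult_add_rdistrib)
    with Ex ker show ?thesis by blast
  qed
  then obtain C where CB: "C ** B = mat 1"
    using matrix_left_invertible_ker[of B] by blast
  then have BC: "B ** C = mat 1"
    by (simp add: matrix_left_right_inverse)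
  have EC: "E ** C = E"
    by (metis BC EB matrix_mul_assoc matrix_mul_rid)
  have CE: "C ** E = E"
    by (metis BE CB matrix_mul_assoc matrix_mul_lid)
  have BT: "transpose B = B"
    by (simp add: B_def transpose_add A E)
  have CT: "transpose C = C"
    by (metis BC BT CB matrix_mul_assoc matrix_mul_lid matrix_mul_rid matrix_transpose_mul transpose_mat)
  \<comment> \<open>The inverse \<open>C\<close> of \<open>B\<close> fixes the range of
    \<open>E\<close>, where the pseudoinverse of \<open>A\<close> has to vanish.\<close>
  define X where "X = C - E"
  have A_eq: "A = B - E" by (simp add: B_def)
  have AX: "A ** X = mat 1 - E"
    by (simp add: A_eq X_def matrix_sub_ldistrib matrix_sub_rdistrib BC BE EC E)
  have XA: "X ** A = mat 1 - E"
    by (simp add: A_eq X_def matrix_sub_ldistrib matrix_sub_rdistrib CB CE EB E)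
  have EX: "E ** X = 0"
    by (simp add: X_def matrix_sub_ldistrib EC E)
  have "is_pseudoinverse A X"
    unfolding is_pseudoinverse_def AX XA
    by (simp add: matrix_sub_rdistrib EA EX transpose_diff E)
  then have P: "pseudoinverse A = X" by (rule pseudoinverse_eqI)
  show "transpose (pseudoinverse A) = pseudoinverse A"
    by (simp add: P X_def transpose_diff CT E)
  show "A ** pseudoinverse A = mat 1 - E" "E ** pseudoinverse A = 0"
    by (simp_all add: P AX EX)
qed

section \<open>Weighted Laplacians and connectivity\<close>

text \<open>As a sum of rank-one terms, one for each column of \<open>D\<close>, the matrix loses
  just one summand when an edge is deleted.\<close>

lemma weighted_gram_mult_vec:
  "(D ** diag_matrix w ** transpose D) *v x = (\<Sum>l\<in>UNIV. (w l * (column l D \<bullet> x)) *\<^sub>R column l D)"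
proof -
  have "(diag_matrix w *v y) $ l = w l * y $ l" for y l
    by (simp add: diag_matrix_def matrix_vector_mult_def if_distrib[of "\<lambda>a. a * _"] cong: if_cong)
  moreover have "(transpose D *v x) $ l = column l D \<bullet> x" for l
    by (simp add: transpose_def matrix_vector_mult_def column_def inner_vec_def)
  ultimately show ?thesis
    by (simp add: matrix_vector_mul_assoc[symmetric] matrix_mult_sum[of D] scalar_mult_eq_scaleR)
qed

lemma weighted_gram_inner:
  "x \<bullet> ((D ** diag_matrix w ** transpose D) *v x) = (\<Sum>l\<in>UNIV. w l * (column l D \<bullet> x)\<^sup>2)"
  by (simp add: weighted_gram_mult_vec inner_sum_right power2_eq_square inner_commute ac_simps)

lemma transpose_weighted_gram:
  "transpose (D ** diag_matrix w ** transpose D) = D ** diag_matrix w ** transpose D"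
proof -
  have "transpose (diag_matrix w) = diag_matrix w"
    by (auto simp: diag_matrix_def transpose_def vec_eq_iff)
  then show ?thesis
    by (simp add: matrix_transpose_mul matrix_mul_assoc)
qed

lemma e_vec_axis: "i \<noteq> j \<Longrightarrow> e_vec i j = axis i 1 - axis j 1"
  by (auto simp: e_vec_def axis_def vec_eq_iff)

lemma inner_e_vec: "i \<noteq> j \<Longrightarrow> e_vec i j \<bullet> x = x $ i - x $ j"
  by (simp add: e_vec_axis inner_diff_left inner_axis')

lemma graph_connected_imp_constant:
  assumes "graph_connected ends" and "\<And>l a b. ends l = {a, b} \<Longrightarrow> h a = h b"
  shows "h u = h v"
proof -
  have "(u, v) \<in> {(a, b). \<exists>l. ends l = {a, b}}\<^sup>*"
    using assms(1) by (simp add: graph_connected_def)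
  then show ?thesis
    by (induction rule: rtrancl_induct) (use assms(2) in auto)
qed

text \<open>The quadratic form is a sum of nonnegative terms, one per edge, so each of them
  vanishes. As the weights are positive, \<open>x\<close> agrees at the two ends of every edge,
  hence along every path.\<close>

lemma laplacian_zero_imp_constant:
  assumes D: "incidence_matrix ends D" and conn: "graph_connected ends"
    and w: "\<And>l. 0 < w l"
    and zero: "x \<bullet> ((D ** diag_matrix w ** transpose D) *v x) = 0"
  shows "x \<in> span {1}"
proof -
  have "\<forall>l\<in>UNIV. w l * (column l D \<bullet> x)\<^sup>2 = 0"
    using zero w by (subst sum_nonneg_eq_0_iff[symmetric]) (auto simp: weighted_gram_inner less_imp_le)
  then have *: "column l D \<bullet> x = 0" for l
    using w[of l] by (metis UNIV_I less_irrefl mult_eq_0_iff power_eq_0_iff)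
  have edge: "x $ a = x $ b" if ab: "ends l = {a, b}" for l a b
  proof -
    obtain u v where "u \<noteq> v" "ends l = {u, v}" "column l D = e_vec u v"
      using D unfolding incidence_matrix_def by blast
    then show ?thesis
      using *[of l] ab by (auto simp: inner_e_vec doubleton_eq_iff)
  qed
  have "x $ u = x $ v" for u v
    using graph_connected_imp_constant[OF conn, of "\<lambda>u. x $ u"] edge by blast
  \<comment> \<open>Here \<open>undefined\<close> is merely some node at which the common value is
    read off.\<close>
  then have "x = (x $ undefined) *\<^sub>R 1"
    by (simp add: vec_eq_iff)
  then show ?thesis
    unfolding span_singleton by blast
qed

lemma laplacian_mult_one:
  assumes "incidence_matrix ends D"
  shows "(D ** diag_matrix w ** transpose D) *v 1 = 0"
proof -
  have "column l D \<bullet> 1 = 0" for l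
    using assms by (metis incidence_matrix_def inner_e_vec one_index cancel_comm_monoid_add_class.diff_cancel)
  then show ?thesis
    by (simp add: weighted_gram_mult_vec)
qed

text \<open>\<open>E\<close> projects onto the constant vectors, the kernel of a connected Laplacian
  with positive weights, and so can serve as the projection in
  \<open>symmetric_pseudoinverse\<close>.\<close>

lemma averaging_projection:
  fixes E :: "real ^ 'n ^ 'n"
  assumes "E = (\<chi> u v. 1 / CARD('n))"
  shows "transpose E = E" "E ** E = E" "E *v x = ((1 \<bullet> x) / CARD('n)) *\<^sub>R 1"
  by (simp_all add: assms transpose_def matrix_matrix_mult_def matrix_vector_mult_def vec_eq_iff
      inner_vec_def sum_divide_distrib)

section \<open>Rank-one updates of a semidefinite matrix with kernel spanned by
  \<open>1\<close>\<close>

text \<open>The graph is abstracted away: \<open>A\<close> stands for \<open>L_plus\<close>, and the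
  pseudoinverse enters only through \<open>A *v v = e\<close>. This fixes \<open>v\<close> up to a
  constant vector, which does not affect \<open>r\<close> because \<open>e\<close> is orthogonal to
  \<open>1\<close>.\<close>

locale rank_one_update =
  fixes A L :: "real ^ 'n ^ 'n" and e v :: "real ^ 'n" and k r :: real
  assumes sym: "transpose A = A" and nonneg: "\<And>x. 0 \<le> x \<bullet> (A *v x)"
    and null: "\<And>x. x \<bullet> (A *v x) = 0 \<Longrightarrow> x \<in> span {1}" and one: "A *v 1 = 0"
    and L_mult: "\<And>x. L *v x = A *v x - (k * (e \<bullet> x)) *\<^sub>R e" and L_sym: "transpose L = L"
    and e: "e \<noteq> 0" and Av: "A *v v = e" and r: "r = v \<bullet> e"
begin

lemma ker_A: "A *v x = 0 \<longleftrightarrow> x \<in> span {1}"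
  using null one by (auto simp: span_singleton matrix_vector_mult_scaleR)

lemma inner_e: "e \<bullet> x = v \<bullet> (A *v x)"
  by (metis Av symmetric_inner_matrix_vector[OF sym])

lemma e_one: "e \<bullet> 1 = 0"
  by (simp add: inner_e one)

lemma e_const: "x \<in> span {1} \<Longrightarrow> e \<bullet> x = 0"
  using e_one by (auto simp: span_singleton)

text \<open>Since \<open>r\<close> is \<open>v \<bullet> (A *v v)\<close>, the value zero would make
  \<open>v\<close> constant and \<open>e = A *v v\<close> zero.\<close>

lemma r_pos: "0 < r"
proof -
  have "v \<bullet> (A *v v) \<noteq> 0"
    using e Av null ker_A by metis
  then show ?thesis
    using nonneg[of v] by (simp add: r Av)
qed

text \<open>\<open>t *\<^sub>R v\<close> is the projection of \<open>x\<close> onto the line of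
  \<open>v\<close> in the \<open>A\<close>-inner product: \<open>e \<bullet> x\<close> and
  \<open>r\<close> are the products of \<open>v\<close> with \<open>x\<close> and with
  itself.\<close>

lemma complete_square:
  assumes "t = (e \<bullet> x) / r"
  shows "x \<bullet> (L *v x) = (x - t *\<^sub>R v) \<bullet> (A *v (x - t *\<^sub>R v)) + (inverse r - k) * (e \<bullet> x)\<^sup>2"
proof -
  have "(x - t *\<^sub>R v) \<bullet> (A *v (x - t *\<^sub>R v)) = x \<bullet> (A *v x) - 2 * t * (e \<bullet> x) + t\<^sup>2 * r"
    by (simp add: matrix_vector_mult_diff_distrib matrix_vector_mult_scaleR Av inner_diff_left
        inner_diff_right inner_e[symmetric] r power2_eq_square inner_commute[of x e] algebra_simps)
  also have "\<dots> = x \<bullet> (A *v x) - inverse r * (e \<bullet> x)\<^sup>2"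
    using r_pos by (simp add: assms power2_eq_square field_simps)
  finally show ?thesis
    by (simp add: L_mult inner_diff_right inner_commute[of x e] power2_eq_square algebra_simps)
qed

text \<open>For \<open>x\<close> in the kernel, \<open>A\<close> maps \<open>x\<close> and
  \<open>c *\<^sub>R v\<close> to the same vector, where c is \<open>k * (e \<bullet> x)\<close>;
  pairing their difference with \<open>e\<close> yields the condition on c. Its product form serves
  both corank computations: c is either forced to be zero or free.\<close>

lemma ker_L:
  "L *v x = 0 \<longleftrightarrow> (\<exists>c. x - c *\<^sub>R v \<in> span {1} \<and> c * (1 - k * r) = 0)"
proof
  assume "L *v x = 0"
  then have "A *v (x - (k * (e \<bullet> x)) *\<^sub>R v) = 0"
    by (simp add: L_mult matrix_vector_mult_diff_distrib matrix_vector_mult_scaleR Av)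
  then have x: "x - (k * (e \<bullet> x)) *\<^sub>R v \<in> span {1}" (is "?y \<in> _")
    by (simp add: ker_A)
  then have "e \<bullet> ?y = 0" by (rule e_const)
  then have "e \<bullet> x = k * (e \<bullet> x) * r"
    by (simp add: inner_diff_right r inner_commute)
  then have "k * (e \<bullet> x) * (1 - k * r) = 0"
    by (simp add: algebra_simps)
  with x show "\<exists>c. x - c *\<^sub>R v \<in> span {1} \<and> c * (1 - k * r) = 0" by blast
next
  assume "\<exists>c. x - c *\<^sub>R v \<in> span {1} \<and> c * (1 - k * r) = 0"
  then obtain c where c: "x - c *\<^sub>R v \<in> span {1}" "c * (1 - k * r) = 0" by blast
  have ex: "e \<bullet> x = c * r"
    using e_const[OF c(1)] by (simp add: inner_diff_right r inner_commute)
  have "A *v x = c *\<^sub>R e"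
    using c(1) by (simp add: ker_A[symmetric] matrix_vector_mult_diff_distrib matrix_vector_mult_scaleR Av)
  then have "L *v x = (c * (1 - k * r)) *\<^sub>R e"
    by (simp add: L_mult ex algebra_simps)
  then show "L *v x = 0" using c(2) by simp
qed

lemma corank_one: "k \<noteq> inverse r \<Longrightarrow> corank L = 1"
proof -
  assume "k \<noteq> inverse r"
  then have "1 - k * r \<noteq> 0"
    using r_pos by (auto simp: field_simps)
  then have "{x. L *v x = 0} = span {1}"
    by (auto simp: ker_L)
  then show ?thesis
    by (simp add: corank_def dim_span)
qed

lemma corank_two:
  assumes "k = inverse r"
  shows "corank L = 2"
proof -
  have "1 - k * r = 0"
    using assms r_pos by simp
  then have "{x. L *v x = 0} = span {v, 1}"
    by (auto simp: ker_L span_insert)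
  \<comment> \<open>\<open>A\<close> annihilates \<open>1\<close> but not \<open>v\<close>.\<close>
  moreover have "v \<notin> span {1}"
    using ker_A Av e by metis
  then have "independent {v, 1}" and "v \<noteq> 1"
    by (auto simp: independent_insert intro: span_base)
  ultimately show ?thesis
    by (simp add: corank_def dim_span dim_eq_card_independent)
qed

lemma L_nonneg: "k \<le> inverse r \<Longrightarrow> pos_semidef L"
  unfolding pos_semidef_def using complete_square nonneg L_sym by simp

text \<open>If the form vanishes at \<open>x\<close>, so do both summands of the completed square.
  Then \<open>e \<bullet> x = 0\<close>, hence \<open>t = 0\<close> and \<open>x\<close> is
  constant; orthogonality to \<open>1\<close> leaves only zero.\<close>

lemma L_pos_def: "k < inverse r \<Longrightarrow> pos_def_on (orthogonal_comp {1}) L"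
  unfolding pos_def_on_def
proof (intro conjI ballI impI)
  fix x :: "real ^ 'n"
  assume k: "k < inverse r" and x: "x \<in> orthogonal_comp {1}" "x \<noteq> 0"
  have "x \<bullet> (L *v x) \<noteq> 0"
  proof
    assume *: "x \<bullet> (L *v x) = 0"
    define t where "t = (e \<bullet> x) / r"
    have "0 \<le> (inverse r - k) * (e \<bullet> x)\<^sup>2"
      using k by simp
    then have 0: "(inverse r - k) * (e \<bullet> x)\<^sup>2 = 0" and **: "(x - t *\<^sub>R v) \<bullet> (A *v (x - t *\<^sub>R v)) = 0"
      using complete_square[OF t_def] nonneg[of "x - t *\<^sub>R v"] * by linarith+
    from 0 have "e \<bullet> x = 0"
      using k by simp
    then have "x \<in> span {1}"
      using null[OF **] by (simp add: t_def)
    then obtain c where "x = c *\<^sub>R 1"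
      by (auto simp: span_singleton)
    with x show False
      by (auto simp: orthogonal_comp_def orthogonal_def)
  qed
  moreover have "0 \<le> x \<bullet> (L *v x)"
    using L_nonneg k by (simp add: pos_semidef_def)
  ultimately show "0 < x \<bullet> (L *v x)" by simp
qed (rule L_sym)

lemma L_mult_v: "L *v v = (1 - k * r) *\<^sub>R e"
  by (simp add: L_mult Av r inner_commute algebra_simps)

text \<open>The value at \<open>v\<close> is \<open>(1 - k * r) * r\<close>, a negative number times
  a positive one.\<close>

lemma L_neg: "k > inverse r \<Longrightarrow> v \<bullet> (L *v v) < 0"
  using r_pos mult_neg_pos[of "1 - k * r" r] by (simp add: L_mult_v) (simp add: r[symmetric] field_simps)

text \<open>On the hyperplane orthogonal to \<open>e\<close> the update vanishes, so the forms of
  \<open>L\<close> and \<open>A\<close> agree there.\<close>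

lemma L_pos:
  assumes "e \<bullet> x = 0" "x \<notin> span {1}"
  shows "0 < x \<bullet> (L *v x)"
proof -
  have "0 < x \<bullet> (A *v x)"
    using nonneg[of x] null[of x] assms(2) by force
  then show ?thesis
    using assms(1) by (simp add: L_mult)
qed

end

section \<open>The signed Laplacian as a rank-one update of \<open>L_plus\<close>\<close>

theorem theorem1:
  fixes ends :: "'m::finite \<Rightarrow> 'n::finite set"
    and w :: "'m \<Rightarrow> real" and k :: real
    and D :: "real ^ 'm ^ 'n" and W :: "real ^ 'm ^ 'm" and L :: "real ^ 'n ^ 'n"
    and l_minus :: 'm and i j :: 'n
    and f :: "'p::finite \<Rightarrow> 'm"
    and D_plus :: "real ^ 'p ^ 'n" and W_plus :: "real ^ 'p ^ 'p" and L_plus :: "real ^ 'n ^ 'n"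
    and r :: real and v :: "real ^ 'n"
  assumes D: "incidence_matrix ends D"
    and W: "W = diag_matrix w"
    and L: "L = D ** W ** transpose D"
    and neg_edge: "i \<noteq> j" "ends l_minus = {i, j}" "w l_minus = - k" "- k < 0"
    and pos_edges: "\<And>l. l \<noteq> l_minus \<Longrightarrow> 0 < w l"
    and f: "bij_betw f UNIV (UNIV - {l_minus})"
    and D_plus: "D_plus = keep_columns f D"
    and W_plus: "W_plus = keep_rows_columns f W"
    and L_plus: "L_plus = D_plus ** W_plus ** transpose D_plus"
    and connected: "graph_connected (ends \<circ> f)"
    and r: "r = effective_resistance L_plus i j"
    and v: "v = pseudoinverse L_plus *v e_vec i j"
  shows "0 < r \<and>
    (k < inverse r \<longrightarrow>
      pos_semidef L \<and> corank L = 1 \<and> pos_def_on (orthogonal_comp {1}) L) \<and>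
    (k = inverse r \<longrightarrow>
      pos_semidef L \<and> corank L = 2 \<and> v \<in> orthogonal_comp {1} \<and> L *v v = 0) \<and>
    (k > inverse r \<longrightarrow>
      \<not> pos_semidef L \<and> (CARD('n) \<ge> 3 \<longrightarrow> indefinite L) \<and> corank L = 1)"
proof -
  let ?e = "e_vec i j"
  have inj: "inj f" and ran: "range f = UNIV - {l_minus}"
    using f by (auto simp: bij_betw_def)
  \<comment> \<open>Injectivity of \<open>f\<close> keeps the off-diagonal entries zero.\<close>
  have W_plus': "W_plus = diag_matrix (w \<circ> f)"
    using inj by (auto simp: W_plus W keep_rows_columns_def diag_matrix_def vec_eq_iff inj_eq)
  have col: "column p D_plus = column (f p) D" for p
    by (simp add: D_plus keep_columns_def column_def)
  have inc: "incidence_matrix (ends \<circ> f) D_plus"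
    using D by (simp add: incidence_matrix_def col)
  have w_pos: "0 < (w \<circ> f) p" for p
    using pos_edges[of "f p"] ran by auto
  have L_plus': "L_plus = D_plus ** diag_matrix (w \<circ> f) ** transpose D_plus"
    by (simp add: L_plus W_plus')
  have sym: "transpose L_plus = L_plus"
    unfolding L_plus' by (rule transpose_weighted_gram)
  have nonneg: "0 \<le> x \<bullet> (L_plus *v x)" for x
    unfolding L_plus' weighted_gram_inner using w_pos by (intro sum_nonneg) (simp add: less_imp_le)
  have null: "x \<in> span {1}" if "x \<bullet> (L_plus *v x) = 0" for x
    using that unfolding L_plus'
    by (rule laplacian_zero_imp_constant[OF inc connected,
          where w = "w \<circ> f", OF w_pos])
  have one: "L_plus *v 1 = 0"
    unfolding L_plus' by (rule laplacian_mult_one[OF inc])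

  \<comment> \<open>The orientation of this column is arbitrary, but the column enters its rank-one
    term twice, so the sign will cancel.\<close>
  have col_minus: "column l_minus D = ?e \<or> column l_minus D = - ?e"
  proof -
    obtain a b where ab: "a \<noteq> b" "ends l_minus = {a, b}" "column l_minus D = e_vec a b"
      using D unfolding incidence_matrix_def by blast
    have "(a = i \<and> b = j) \<or> (a = j \<and> b = i)"
      using ab(2) neg_edge(2) by (auto simp: doubleton_eq_iff)
    then show ?thesis
      using ab(1,3) by (auto simp: e_vec_axis)
  qed
  have L_mult: "L *v x = L_plus *v x - (k * (?e \<bullet> x)) *\<^sub>R ?e" for x
  proof -
    let ?g = "\<lambda>l. (w l * (column l D \<bullet> x)) *\<^sub>R column l D"
    have "L *v x = ?g l_minus + sum ?g (range f)"
      by (simp add: L W weighted_gram_mult_vec ran sum.remove)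
    also have "sum ?g (range f) = L_plus *v x"
      unfolding L_plus' weighted_gram_mult_vec by (simp add: sum.reindex inj col)
    also have "?g l_minus = - ((k * (?e \<bullet> x)) *\<^sub>R ?e)"
      using col_minus neg_edge(3) by auto
    finally show ?thesis by simp
  qed

  define E :: "real ^ 'n ^ 'n" where "E = (\<chi> u v. 1 / CARD('n))"
  note E = averaging_projection[OF E_def]
  have "(L_plus ** E) *v x = 0" for x
    by (simp add: matrix_vector_mul_assoc[symmetric] E(3) matrix_vector_mult_scaleR one)
  then have LE: "L_plus ** E = 0"
    by (simp add: matrix_eq)
  have ker: "x = 0" if Lx: "L_plus *v x = 0" and Ex: "E *v x = 0" for x
  proof -
    obtain c where c: "x = c *\<^sub>R 1"
      using null[of x] unfolding Lx inner_zero_right span_singleton by blast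
    have "1 \<bullet> x = 0"
      using Ex by (simp add: E(3) vec_eq_iff)
    then have "c = 0"
      by (simp add: c inner_vec_def)
    with c show ?thesis by simp
  qed
  let ?P = "pseudoinverse L_plus"
  note P = symmetric_pseudoinverse[OF sym E(1,2) LE ker]
  \<comment> \<open>\<open>?e\<close> is orthogonal to \<open>1\<close>, so it is fixed by
    \<open>mat 1 - E\<close>, the product of \<open>L_plus\<close> and its pseudoinverse.\<close>
  have Ee: "E *v ?e = 0"
    using neg_edge(1) by (simp add: E(3) inner_commute[of 1] inner_e_vec)
  have Lv: "L_plus *v v = ?e"
    by (simp add: v matrix_vector_mul_assoc P(2) matrix_vector_mult_diff_rdistrib Ee)
  have "E *v v = 0"
    by (simp add: v matrix_vector_mul_assoc P(3))
  then have v_one: "v \<bullet> 1 = 0"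
    by (simp add: E(3) inner_commute vec_eq_iff)
  \<comment> \<open>Symmetry merges the two off-diagonal terms of
    \<open>?e \<bullet> (?P *v ?e)\<close> into the last term of the effective resistance.\<close>
  have "?P $ j $ i = ?P $ i $ j"
    using arg_cong[OF P(1), of "\<lambda>M. M $ i $ j"] by (simp add: transpose_def)
  then have r': "r = v \<bullet> ?e"
    using neg_edge(1)
    by (simp add: r v effective_resistance_def inner_commute[of _ ?e] inner_e_vec)
       (simp add: e_vec_axis matrix_vector_mult_diff_distrib matrix_vector_mul_component inner_axis)
  have e: "?e \<noteq> 0"
    by (auto simp: e_vec_def vec_eq_iff)
  have L_sym: "transpose L = L"
    unfolding L W by (rule transpose_weighted_gram)
  interpret rank_one_update L_plus L ?e v k r
    by unfold_locales (fact sym nonneg null one L_mult L_sym e Lv r')+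

  \<comment> \<open>A third node supplies the positive direction: its axis vector is orthogonal to
    \<open>?e\<close> and not constant. With only two nodes, every vector orthogonal to
    \<open>?e\<close> is constant.\<close>
  have "indefinite L" if k: "k > inverse r" and n: "CARD('n) \<ge> 3"
  proof -
    have "card {i, j} < CARD('n)"
      using n by (simp add: card_insert_if)
    then have "{i, j} \<noteq> UNIV" by auto
    then obtain u where u: "u \<noteq> i" "u \<noteq> j"
      by blast
    have "axis u 1 \<notin> span {1 :: real ^ 'n}"
    proof
      assume "axis u 1 \<in> span {1 :: real ^ 'n}"
      then obtain c where "axis u 1 = c *\<^sub>R (1 :: real ^ 'n)"
        by (auto simp: span_singleton)
      then have "axis u (1::real) $ u = axis u 1 $ i" by simp
      then show False using u(1) by (simp add: axis_def)
    qed
    moreover have "?e \<bullet> axis u 1 = 0"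
      using u neg_edge(1) by (simp add: inner_e_vec axis_def)
    ultimately show ?thesis
      using L_neg[OF k] L_pos L_sym by (auto simp: indefinite_def)
  qed
  moreover have "\<not> pos_semidef L" if "k > inverse r"
    using L_neg[OF that] by (auto simp: pos_semidef_def not_le)
  moreover have "L *v v = 0" if "k = inverse r"
    using that r_pos by (simp add: L_mult_v)
  moreover have "v \<in> orthogonal_comp {1}"
    using v_one by (simp add: orthogonal_comp_def orthogonal_def inner_commute)
  ultimately show ?thesis
    using r_pos corank_one corank_two L_nonneg L_pos_def by simp
qed

end
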